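(* Let $\phi$ be a conjunction of xor-clauses in 3-xor normal form with $\mathrm{vars}(\phi)=\{x_1,\dots,x_m\}$. For each pair of distinct indices $i,j$ let $e_{ij}=e_{ji}$ be a new variable (not in $\mathrm{vars}(\phi)$, and distinct for distinct pairs), and let $$\mathrm{Eq}(\phi)=\bigwedge_{(x_i\oplus x_j\oplus x_k\equiv p)\in\phi}(e_{ij}\oplus x_k\oplus\top\equiv p)\wedge(e_{ik}\oplus x_j\oplus\top\equiv p)\wedge(x_i\oplus e_{jk}\oplus\top\equiv p)\ \wedge\bigwedge_{1\le i<j<k\le m}(e_{ij}\oplus e_{jk}\oplus e_{ik}\equiv\top).$$ Then $\mathrm{Eq}(\phi)$ is an EC-simulation formula for $\phi$.
   Context: **Xor-clauses.** An xor-clause is an equation $z_1\oplus\dots\oplus z_k\equiv p$ over distinct propositional variables with $p\in\{\bot,\top\}$ ($\oplus$ is exclusive or); equations are always simplified to normal form by cancelling repeated variables in pairs and moving constants to the right-hand side. The literal $x$ is identified with $(x\equiv\top)$ and $\neg x$ with $(x\equiv\bot)$. The unsatisfiable empty xor-clause is identified with $\bot$. $\mathrm{vars}(\phi)$ is the set of variables of $\phi$ and $\mathrm{lits}(\phi)=\{x,\neg x\mid x\in\mathrm{vars}(\phi)\}$. **3-xor normal form.** $\phi$ is in 3-xor normal form if (i) every xor-clause in it has exactly three variables, and (ii) each pair of distinct xor-clauses in it shares at most one variable. **UP.** $C[x/D]$ is the normal form of the xor-clause obtained from $C$ by replacing $x$ by $D$. Rules: from $(x\equiv\top)$ and an xor-clause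 $C$ infer $C[x/\top]$; from $(x\equiv\bot)$ and $C$ infer $C[x/\bot]$. **EC.** Rules (letters are generic variables; variables in one displayed xor-clause are distinct, $x_1,\dots,x_n$ pairwise distinct, $a,b,c_i,d\in\{\bot,\top\}$): from $(x\equiv\top),(x\equiv\bot)$ infer $\bot$; from $(x\equiv a),(x\oplus y\equiv b)$ infer $(y\equiv a\oplus b)$; from $(x\equiv a),(x\oplus y\oplus z\equiv b)$ infer $(y\oplus z\equiv a\oplus b)$; from $(x_1\oplus x_2\equiv c_1),\dots,(x_{n-1}\oplus x_n\equiv c_{n-1}),(x_1\oplus x_n\oplus y\equiv d)$ infer $(y\equiv c_1\oplus\dots\oplus c_{n-1}\oplus d)$; from $(x_1\oplus x_2\equiv c_1),\dots,(x_{n-1}\oplus x_n\equiv c_{n-1}),(x_n\oplus x_1\equiv c_n)$ with $c_1\oplus\dots\oplus c_n=\top$ infer $\bot$. **Derivability.** For $S\in\{\mathrm{UP},\mathrm{EC}\}$, $D$ is $S$-derivable from $\psi$ if $D$ occurs in a finite sequence of xor-clauses each of which is in $\psi$ or is inferred from earlier ones by a rule of $S$. **EC-simulation formula.** A conjunction $\psi$ of xor-clauses (possibly with variables not in $\phi$) is an EC-simulation formula for $\phi$ if (i) the satisfying truth assignments of $\phi$ are exactly those of $\phi\wedge\psi$ projected to $\mathrm{vars}(\phi)$, and (ii) for all $k\ge 0$, $\tilde l_1,\dots,\tilde l_k\in\mathrm{lits}(\phi)$ and every literal $\hat l$, if $\hat l$ is EC-derivable from $\phi\wedge\tilde l_1\wedge\dots\wedge\tilde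 l_k$, then $\hat l$ is UP-derivable from $(\phi\wedge\psi)\wedge\tilde l_1\wedge\dots\wedge\tilde l_k$. *)

theory Defs
  imports Main
begin

text \<open>
  \<open>Xor V p\<close> is the xor-clause (in normal form) stating that the exclusive or of the
  variables in \<open>V\<close> equals \<open>p\<close>. The set \<open>V\<close> is meant to be finite, see \<open>xor_formula\<close> below.
  On \<^typ>\<open>bool\<close>, exclusive or of two values is \<open>(\<noteq>)\<close>.
\<close>
datatype 'v xor_clause = Xor (cvars: "'v set") (parity: bool)

abbreviation unit_xor :: "'v \<Rightarrow> bool \<Rightarrow> 'v xor_clause" where
  "unit_xor x b \<equiv> Xor {x} b"

abbreviation xor_bot :: "'v xor_clause" where
  "xor_bot \<equiv> Xor {} True"

definition is_literal :: "'v xor_clause \<Rightarrow> bool" where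
  "is_literal C \<longleftrightarrow> (\<exists>x b. C = unit_xor x b)"

definition big_xor :: "('i \<Rightarrow> bool) \<Rightarrow> 'i set \<Rightarrow> bool" where
  "big_xor c I \<longleftrightarrow> odd (card {i \<in> I. c i})"

text \<open>A conjunction of xor-clauses is represented by the finite set of its conjuncts.\<close>

type_synonym 'v xor_formula = "'v xor_clause set"

definition xor_formula :: "'v xor_formula \<Rightarrow> bool" where
  "xor_formula F \<longleftrightarrow> finite F \<and> (\<forall>C\<in>F. finite (cvars C))"

definition vars :: "'v xor_formula \<Rightarrow> 'v set" where
  "vars F = (\<Union>C\<in>F. cvars C)"

definition lits :: "'v xor_formula \<Rightarrow> 'v xor_clause set" where
  "lits F = {unit_xor x b | x b. x \<in> vars F}"

definition three_xor_normal_form :: "'v xor_formula \<Rightarrow> bool" where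
  "three_xor_normal_form F \<longleftrightarrow>
     (\<forall>C\<in>F. card (cvars C) = 3) \<and>
     (\<forall>C\<in>F. \<forall>D\<in>F. C \<noteq> D \<longrightarrow> card (cvars C \<inter> cvars D) \<le> 1)"

text \<open>
  A truth assignment of a formula is a map whose domain is exactly the set of variables
  of the formula.
\<close>

definition satisfies :: "('v \<rightharpoonup> bool) \<Rightarrow> 'v xor_clause \<Rightarrow> bool" where
  "satisfies \<tau> C \<longleftrightarrow> big_xor (\<lambda>v. \<tau> v = Some True) (cvars C) = parity C"

definition models :: "'v xor_formula \<Rightarrow> ('v \<rightharpoonup> bool) set" where
  "models F = {\<tau>. dom \<tau> = vars F \<and> (\<forall>C\<in>F. satisfies \<tau> C)}"

text \<open>Replacing \<open>x\<close> by the constant \<open>b\<close>; the constant is moved to the right-hand side.\<close>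

definition subst_const :: "'v xor_clause \<Rightarrow> 'v \<Rightarrow> bool \<Rightarrow> 'v xor_clause" where
  "subst_const C x b =
     (if x \<in> cvars C then Xor (cvars C - {x}) (parity C \<noteq> b) else C)"

text \<open>A system is a relation between the set of premises of an inference and its conclusion.\<close>

inductive UP :: "'v xor_clause set \<Rightarrow> 'v xor_clause \<Rightarrow> bool" where
  pos: "UP {unit_xor x True, C} (subst_const C x True)"
| neg: "UP {unit_xor x False, C} (subst_const C x False)"

text \<open>
  In \<open>path\<close> and \<open>cycle\<close> the case \<open>n = 1\<close> is excluded because the variables of each
  displayed clause are distinct; \<open>y\<close> may be one of the inner variables of the path.
\<close>

inductive EC :: "'v xor_clause set \<Rightarrow> 'v xor_clause \<Rightarrow> bool" where
  conflict: "EC {unit_xor x True, unit_xor x False} xor_bot"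
| unit2: "x \<noteq> y \<Longrightarrow> EC {unit_xor x a, Xor {x, y} b} (unit_xor y (a \<noteq> b))"
| unit3: "distinct [x, y, z] \<Longrightarrow>
    EC {unit_xor x a, Xor {x, y, z} b} (Xor {y, z} (a \<noteq> b))"
| path: "\<lbrakk>(n::nat) \<ge> 2; inj_on x {1..n}; y \<noteq> x 1; y \<noteq> x n\<rbrakk> \<Longrightarrow>
    EC ({Xor {x i, x (i + 1)} (c i) | i. 1 \<le> i \<and> i < n} \<union> {Xor {x 1, x n, y} d})
       (unit_xor y (big_xor c {1..<n} \<noteq> d))"
| cycle: "\<lbrakk>(n::nat) \<ge> 2; inj_on x {1..n}; big_xor c {1..n}\<rbrakk> \<Longrightarrow>
    EC ({Xor {x i, x (i + 1)} (c i) | i. 1 \<le> i \<and> i < n} \<union> {Xor {x n, x 1} (c n)})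
       xor_bot"

definition derivable ::
  "('v xor_clause set \<Rightarrow> 'v xor_clause \<Rightarrow> bool) \<Rightarrow> 'v xor_formula \<Rightarrow> 'v xor_clause \<Rightarrow> bool" where
  "derivable S F D \<longleftrightarrow>
     (\<exists>Cs. D \<in> set Cs \<and>
       (\<forall>i < length Cs. Cs ! i \<in> F \<or> (\<exists>P. P \<subseteq> set (take i Cs) \<and> S P (Cs ! i))))"

definition EC_simulation_formula :: "'v xor_formula \<Rightarrow> 'v xor_formula \<Rightarrow> bool" where
  "EC_simulation_formula F G \<longleftrightarrow>
     xor_formula G \<and>
     models F = (\<lambda>\<tau>. \<tau> |` vars F) ` models (F \<union> G) \<and>
     (\<forall>ls l. set ls \<subseteq> lits F \<and> is_literal l \<and> derivable EC (F \<union> set ls) l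
        \<longrightarrow> derivable UP ((F \<union> G) \<union> set ls) l)"

text \<open>
  The variables of the formula are \<open>x 1, \<dots>, x m\<close>. The sets of variables below have as many
  elements as displayed provided that the \<open>x i\<close> are distinct and the \<open>e i j\<close> are fresh and
  distinct for distinct unordered pairs of indices. In \<open>e i j \<oplus> x k \<oplus> \<top> \<equiv> p\<close> the constant
  is moved to the right-hand side, which gives \<open>p \<noteq> True\<close>.
\<close>

definition Eq :: "nat \<Rightarrow> (nat \<Rightarrow> 'v) \<Rightarrow> (nat \<Rightarrow> nat \<Rightarrow> 'v) \<Rightarrow> 'v xor_formula \<Rightarrow> 'v xor_formula" where
  "Eq m x e F =
     (\<Union> {{Xor {e i j, x k} (p \<noteq> True), Xor {e i k, x j} (p \<noteq> True), Xor {x i, e j k} (p \<noteq> True)}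
          | i j k p. {i, j, k} \<subseteq> {1..m} \<and> distinct [i, j, k] \<and> Xor {x i, x j, x k} p \<in> F})
     \<union> {Xor {e i j, e j k, e i k} True | i j k. 1 \<le> i \<and> i < j \<and> j < k \<and> k \<le> m}"

end

theory Submission
  imports Defs
begin

text \<open>
  The variable \<open>e i j\<close> stands for \<open>x i \<equiv> x j\<close>, which determines the extension of a model.
  For the simulation, the only two-variable clauses an EC-derivation can contain are
  conclusions of the ternary rule, that is, \<open>u \<oplus> v \<equiv> b\<close> where some \<open>u \<oplus> v \<oplus> w \<equiv> p\<close> of
  the formula has \<open>w\<close> already derived. UP then derives the variable for the
  equivalence of \<open>u\<close> and \<open>v\<close>, the triangle clauses propagate these values along a path, and
  the clause combining the variable of the end points with \<open>y\<close> yields the conclusion of the path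
  rule.
\<close>

section \<open>Parity of sums and satisfaction of clauses\<close>

lemma big_xor_empty [simp]: "big_xor c {} = False"
  by (simp add: big_xor_def)

text \<open>One more index flips the parity of the cardinality exactly when \<open>c i\<close>
  holds. This turns counting into iterated xor, one new element at a time.\<close>

lemma big_xor_insert:
  assumes "finite I" "i \<notin> I"
  shows "big_xor c (insert i I) = (c i \<noteq> big_xor c I)"
proof -
  have "{k \<in> insert i I. c k} = (if c i then insert i {k \<in> I. c k} else {k \<in> I. c k})"
    by auto
  then show ?thesis
    using assms by (simp add: big_xor_def)
qed

lemma big_xor_cong:
  assumes "\<And>i. i \<in> I \<Longrightarrow> c i = d i"
  shows "big_xor c I = big_xor d I"
proof -
  have "{i \<in> I. c i} = {i \<in> I. d i}"
    using assms by auto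
  then show ?thesis
    by (simp add: big_xor_def)
qed

lemma satisfies_cong:
  assumes "\<And>v. v \<in> cvars C \<Longrightarrow> s v = t v"
  shows "satisfies s C = satisfies t C"
  using assms big_xor_cong[of "cvars C" "\<lambda>v. s v = Some True" "\<lambda>v. t v = Some True"]
  by (simp add: satisfies_def)

section \<open>Building derivations and inducting over them\<close>

lemma derivable_base:
  assumes "C \<in> F"
  shows "derivable S F C"
  unfolding derivable_def using assms by (intro exI[of _ "[C]"]) simp

text \<open>The two derivations are concatenated and \<open>C\<close> is appended; clauses of the
  second block keep their justification because the prefix before them only grows. Two premises
  suffice for the rules of UP, the system in which derivations are built below.\<close>

lemma derivable_step:
  assumes "derivable S F A" "derivable S F B" "S {A, B} C"
  shows "derivable S F C"
proof -
  obtain As where As: "A \<in> set As"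
    "\<And>i. i < length As \<Longrightarrow> As ! i \<in> F \<or> (\<exists>P. P \<subseteq> set (take i As) \<and> S P (As ! i))"
    using assms(1) unfolding derivable_def by blast
  obtain Bs where Bs: "B \<in> set Bs"
    "\<And>i. i < length Bs \<Longrightarrow> Bs ! i \<in> F \<or> (\<exists>P. P \<subseteq> set (take i Bs) \<and> S P (Bs ! i))"
    using assms(2) unfolding derivable_def by blast
  let ?Cs = "As @ Bs @ [C]"
  have "?Cs ! i \<in> F \<or> (\<exists>P. P \<subseteq> set (take i ?Cs) \<and> S P (?Cs ! i))" if i: "i < length ?Cs" for i
  proof -
    consider "i < length As" | "length As \<le> i" "i < length As + length Bs"
      | "i = length As + length Bs"
      using i by fastforce
    then show ?thesis
    proof cases
      case 1
      then show ?thesis using As(2)[of i] by (simp add: nth_append)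
    next
      case 2
      then have "?Cs ! i = Bs ! (i - length As)"
        "set (take (i - length As) Bs) \<subseteq> set (take i ?Cs)" "i - length As < length Bs"
        by (auto simp: nth_append)
      then show ?thesis using Bs(2)[of "i - length As"] by (metis subset_trans)
    next
      case 3
      have "{A, B} \<subseteq> set (take i ?Cs)" using As(1) Bs(1) 3 by simp
      moreover have "?Cs ! i = C" using 3 by (simp add: nth_append)
      ultimately show ?thesis
        using assms(3) by (intro disjI2 exI[of _ "{A, B}"]) (simp only: simp_thms)
    qed
  qed
  moreover have "C \<in> set ?Cs" by simp
  ultimately show ?thesis
    unfolding derivable_def by blast
qed

text \<open>Premises stand strictly earlier in the sequence, so strong induction on the position
  gives rule induction. The premise set \<open>P\<close> is arbitrary because \<open>path\<close>
  and \<open>cycle\<close> have unboundedly many premises.\<close>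

lemma derivable_induct:
  assumes "derivable S F D"
    and base: "\<And>C. C \<in> F \<Longrightarrow> Q C"
    and step: "\<And>P C. S P C \<Longrightarrow> (\<And>A. A \<in> P \<Longrightarrow> Q A) \<Longrightarrow> Q C"
  shows "Q D"
proof -
  obtain Cs where D: "D \<in> set Cs"
    and Cs: "\<And>i. i < length Cs \<Longrightarrow> Cs ! i \<in> F \<or> (\<exists>P. P \<subseteq> set (take i Cs) \<and> S P (Cs ! i))"
    using assms(1) unfolding derivable_def by blast
  have "Q (Cs ! i)" if "i < length Cs" for i
    using that
  proof (induction i rule: less_induct)
    case (less i)
    have "Q A" if "A \<in> set (take i Cs)" for A
      using that less by (auto simp: in_set_conv_nth)
    then show ?case
      using Cs[OF less.prems] base step by (metis subsetD)
  qed
  then show ?thesis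
    using D by (metis in_set_conv_nth)
qed

lemma derivable_UP_subst:
  assumes "derivable UP F (unit_xor x a)" "derivable UP F C"
  shows "derivable UP F (subst_const C x a)"
proof -
  have "UP {unit_xor x a, C} (subst_const C x a)"
    by (cases a) (auto intro: UP.intros)
  then show ?thesis
    using assms derivable_step by metis
qed

lemma derivable_UP_binary:
  assumes "derivable UP F (unit_xor x a)" "derivable UP F (Xor {x, y} b)" "x \<noteq> y"
  shows "derivable UP F (unit_xor y (a \<noteq> b))"
proof -
  have "subst_const (Xor {x, y} b) x a = unit_xor y (a \<noteq> b)"
    using assms(3) by (auto simp: subst_const_def)
  then show ?thesis
    using derivable_UP_subst[OF assms(1,2)] by simp
qed

lemma derivable_UP_ternary:
  assumes "derivable UP F (unit_xor x a)" "derivable UP F (Xor {x, y, z} b)" "distinct [x, y, z]"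
  shows "derivable UP F (Xor {y, z} (a \<noteq> b))"
proof -
  have "subst_const (Xor {x, y, z} b) x a = Xor {y, z} (a \<noteq> b)"
    using assms(3) by (auto simp: subst_const_def)
  then show ?thesis
    using derivable_UP_subst[OF assms(1,2)] by simp
qed

lemma distinct_of_card3:
  assumes "card {a, b, c} = 3"
  shows "distinct [a, b, c]"
proof -
  have "card {a, b, c} = card (set [a, b, c])" by simp
  then show ?thesis
    using assms by (intro card_distinct) simp
qed

section \<open>Equality variables, addressed by the variables they compare\<close>

locale equality_encoding =
  fixes \<phi> :: "'v xor_formula"
    and m :: nat
    and x :: "nat \<Rightarrow> 'v"
    and e :: "nat \<Rightarrow> nat \<Rightarrow> 'v"
  assumes formula: "xor_formula \<phi>"
    and normal: "three_xor_normal_form \<phi>"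
    and bij: "bij_betw x {1..m} (vars \<phi>)"
    and e_sym: "\<And>i j. i \<in> {1..m} \<Longrightarrow> j \<in> {1..m} \<Longrightarrow> i \<noteq> j \<Longrightarrow> e i j = e j i"
    and e_fresh: "\<And>i j. i \<in> {1..m} \<Longrightarrow> j \<in> {1..m} \<Longrightarrow> i \<noteq> j \<Longrightarrow> e i j \<notin> vars \<phi>"
    and e_inj: "\<And>i j k l. {i, j, k, l} \<subseteq> {1..m} \<Longrightarrow> i \<noteq> j \<Longrightarrow> k \<noteq> l \<Longrightarrow> {i, j} \<noteq> {k, l}
                  \<Longrightarrow> e i j \<noteq> e k l"
begin

definition index :: "'v \<Rightarrow> nat" where
  "index = inv_into {1..m} x"

text \<open>Replaces indices by the variables themselves, so that permutations of a clause need no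
  bookkeeping of positions. Only distinct arguments from \<open>vars \<phi>\<close> are
  meaningful.\<close>

definition E :: "'v \<Rightarrow> 'v \<Rightarrow> 'v" where
  "E u v = e (index u) (index v)"

lemma index_mem: "u \<in> vars \<phi> \<Longrightarrow> index u \<in> {1..m}"
  and x_index: "u \<in> vars \<phi> \<Longrightarrow> x (index u) = u"
  using bij by (metis bij_betw_def index_def inv_into_into, metis bij_betw_def f_inv_into_f index_def)

lemma index_x: "i \<in> {1..m} \<Longrightarrow> index (x i) = i"
  using bij by (simp add: bij_betw_def index_def)

lemma x_mem: "i \<in> {1..m} \<Longrightarrow> x i \<in> vars \<phi>"
  using bij by (auto simp: bij_betw_def)

lemma index_eq_iff: "u \<in> vars \<phi> \<Longrightarrow> v \<in> vars \<phi> \<Longrightarrow> index u = index v \<longleftrightarrow> u = v"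
  by (metis x_index)

lemma E_x: "i \<in> {1..m} \<Longrightarrow> j \<in> {1..m} \<Longrightarrow> E (x i) (x j) = e i j"
  by (simp add: E_def index_x)

lemma E_sym: "u \<in> vars \<phi> \<Longrightarrow> v \<in> vars \<phi> \<Longrightarrow> E u v = E v u"
  unfolding E_def using e_sym[of "index u" "index v"] index_mem by metis

lemma E_fresh: "u \<in> vars \<phi> \<Longrightarrow> v \<in> vars \<phi> \<Longrightarrow> u \<noteq> v \<Longrightarrow> E u v \<notin> vars \<phi>"
  unfolding E_def using e_fresh index_mem index_eq_iff by metis

lemma E_inj:
  assumes "{u, v, u', v'} \<subseteq> vars \<phi>" "u \<noteq> v" "u' \<noteq> v'" "E u v = E u' v'"
  shows "{u, v} = {u', v'}"
proof (rule ccontr)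
  assume ne: "{u, v} \<noteq> {u', v'}"
  have "{index u, index v} \<noteq> {index u', index v'}"
  proof
    assume "{index u, index v} = {index u', index v'}"
    then have "x ` {index u, index v} = x ` {index u', index v'}" by simp
    then show False using ne assms(1) by (simp add: x_index)
  qed
  moreover have "{index u, index v, index u', index v'} \<subseteq> {1..m}"
    using assms(1) index_mem by blast
  ultimately show False
    using e_inj[of "index u" "index v" "index u'" "index v'"] assms index_eq_iff
    by (auto simp: E_def)
qed

section \<open>Clauses of the formula and of its encoding\<close>

lemma clause_vars: "C \<in> \<phi> \<Longrightarrow> cvars C \<subseteq> vars \<phi>"
  by (auto simp: vars_def)

lemma clause_card: "C \<in> \<phi> \<Longrightarrow> card (cvars C) = 3"
  using normal by (simp add: three_xor_normal_form_def)

lemma clause_distinct: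
  assumes "Xor {u, v, w} p \<in> \<phi>"
  shows "distinct [u, v, w]"
  using clause_card[OF assms] unfolding xor_clause.sel by (rule distinct_of_card3)

text \<open>One shape is enough: clauses hold unordered sets, so permuting \<open>u\<close>,
  \<open>v\<close>, \<open>w\<close> yields the other two.\<close>

lemma edge_clause_mem:
  assumes C: "Xor {u, v, w} p \<in> \<phi>"
  shows "Xor {E u v, w} (\<not> p) \<in> Eq m x e \<phi>"
proof -
  have uvw: "u \<in> vars \<phi>" "v \<in> vars \<phi>" "w \<in> vars \<phi>"
    using clause_vars[OF C] by auto
  let ?i = "index u" and ?j = "index v" and ?k = "index w"
  have "{?i, ?j, ?k} \<subseteq> {1..m}"
    using uvw index_mem by blast
  moreover have "distinct [?i, ?j, ?k]"
    using clause_distinct[OF C] uvw by (simp add: index_eq_iff)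
  moreover have "Xor {x ?i, x ?j, x ?k} p \<in> \<phi>"
    using C uvw by (simp add: x_index)
  moreover have "Xor {e ?i ?j, x ?k} (p \<noteq> True) = Xor {E u v, w} (\<not> p)"
    using uvw by (simp add: E_def x_index)
  ultimately show ?thesis
    unfolding Eq_def by blast
qed

text \<open>\<open>Eq\<close> lists triangles for increasing indices only. Each of the six orders of
  the indices leads to the same clause, by symmetry of \<open>e\<close> and commutativity of set
  insertion.\<close>

lemma triangle_clause_mem:
  assumes uvw: "u \<in> vars \<phi>" "v \<in> vars \<phi>" "w \<in> vars \<phi>" "distinct [u, v, w]"
  shows "Xor {E u v, E v w, E u w} True \<in> Eq m x e \<phi>"
proof -
  let ?i = "index u" and ?j = "index v" and ?k = "index w"
  have mem: "?i \<in> {1..m}" "?j \<in> {1..m}" "?k \<in> {1..m}"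
    using uvw index_mem by blast+
  have ne: "?i \<noteq> ?j" "?j \<noteq> ?k" "?i \<noteq> ?k"
    using uvw by (simp_all add: index_eq_iff)
  have sym: "e ?j ?i = e ?i ?j" "e ?k ?j = e ?j ?k" "e ?k ?i = e ?i ?k"
    using e_sym mem ne by metis+
  have triangle: "Xor {e i j, e j k, e i k} True \<in> Eq m x e \<phi>"
    if "i < j" "j < k" "i \<in> {1..m}" "k \<in> {1..m}" for i j k
    using that unfolding Eq_def by auto
  consider "?i < ?j" "?j < ?k" | "?i < ?k" "?k < ?j" | "?j < ?i" "?i < ?k"
    | "?j < ?k" "?k < ?i" | "?k < ?i" "?i < ?j" | "?k < ?j" "?j < ?i"
    using ne by linarith
  then show ?thesis
    unfolding E_def
    by cases (drule (1) triangle; use mem sym in \<open>simp add: insert_commute\<close>)+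
qed

lemma Eq_cases:
  assumes "C \<in> Eq m x e \<phi>"
  obtains (edge) u v w p where "Xor {u, v, w} p \<in> \<phi>" "C = Xor {E u v, w} (\<not> p)"
  | (triangle) u v w where "{u, v, w} \<subseteq> vars \<phi>" "distinct [u, v, w]"
      "C = Xor {E u v, E v w, E u w} True"
proof -
  consider i j k p where "{i, j, k} \<subseteq> {1..m}" "distinct [i, j, k]" "Xor {x i, x j, x k} p \<in> \<phi>"
      "C = Xor {e i j, x k} (p \<noteq> True) \<or> C = Xor {e i k, x j} (p \<noteq> True)
        \<or> C = Xor {x i, e j k} (p \<noteq> True)"
    | i j k where "1 \<le> i" "i < j" "j < k" "k \<le> m" "C = Xor {e i j, e j k, e i k} True"
    using assms unfolding Eq_def by blast
  then show thesis
  proof cases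
    case 1
    \<comment> \<open>Reordering the clause of \<phi> puts any chosen variable last, so the three
      kinds of edge clause become one case.\<close>
    have "Xor {x i, x k, x j} p \<in> \<phi>" "Xor {x j, x k, x i} p \<in> \<phi>"
      using 1(3) by (simp_all add: insert_commute)
    moreover have "C = Xor {E (x i) (x j), x k} (\<not> p) \<or> C = Xor {E (x i) (x k), x j} (\<not> p)
        \<or> C = Xor {E (x j) (x k), x i} (\<not> p)"
      using 1(1,4) by (auto simp: E_x insert_commute)
    ultimately show thesis
      using 1(3) edge by blast
  next
    case 2
    have mem: "i \<in> {1..m}" "j \<in> {1..m}" "k \<in> {1..m}"
      using 2 by auto
    have "distinct [x i, x j, x k]"
      using 2 mem bij by (auto simp: bij_betw_def inj_on_eq_iff)
    then show thesis
      using 2 mem by (intro triangle[of "x i" "x j" "x k"]) (auto simp: E_x x_mem)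
  qed
qed

section \<open>Finiteness of the encoding\<close>

lemma xor_formula_Eq: "xor_formula (Eq m x e \<phi>)"
proof -
  let ?V = "vars \<phi>"
  have fin: "finite ?V"
    using bij bij_betw_finite by blast
  \<comment> \<open>An upper bound for the variables of the encoding; the degenerate values
    \<open>E u u\<close> are harmless. A clause is a subset of \<open>?W\<close> with a bit, which
    leaves finitely many.\<close>
  let ?W = "?V \<union> (\<lambda>(u, v). E u v) ` (?V \<times> ?V)"
  have "C \<in> case_prod Xor ` (Pow ?W \<times> UNIV)" if "C \<in> Eq m x e \<phi>" for C
    using that
  proof (cases rule: Eq_cases)
    case (edge u v w p)
    then show ?thesis
      using clause_vars[OF edge(1)] by (intro image_eqI[of _ _ "({E u v, w}, \<not> p)"]) auto
  next
    case (triangle u v w)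
    then show ?thesis
      by (intro image_eqI[of _ _ "({E u v, E v w, E u w}, True)"]) auto
  qed
  then have sub: "Eq m x e \<phi> \<subseteq> case_prod Xor ` (Pow ?W \<times> UNIV)"
    by blast
  have finW: "finite ?W"
    using fin by simp
  then have "finite (case_prod Xor ` (Pow ?W \<times> (UNIV :: bool set)))"
    by simp
  then have "finite (Eq m x e \<phi>)"
    using sub finite_subset by blast
  moreover have "finite (cvars C)" if "C \<in> Eq m x e \<phi>" for C
  proof -
    have "cvars C \<subseteq> ?W"
      using subsetD[OF sub that] by force
    then show ?thesis
      using finW finite_subset by blast
  qed
  ultimately show ?thesis
    by (simp add: xor_formula_def)
qed

section \<open>Preservation of the models\<close>

lemma model_extension:
  assumes \<tau>: "\<tau> \<in> models \<phi>"
  obtains \<tau>' where "\<tau>' \<in> models (\<phi> \<union> Eq m x e \<phi>)" "\<tau>' |` vars \<phi> = \<tau>"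
proof -
  \<comment> \<open>The intended value of an equality variable. The pair is recovered from the
    variable by an existential; injectivity of \<open>E\<close> on unordered pairs makes the value
    unambiguous.\<close>
  define val where "val v \<longleftrightarrow> (\<exists>a b. a \<in> vars \<phi> \<and> b \<in> vars \<phi> \<and> a \<noteq> b \<and> v = E a b
    \<and> (\<tau> a = Some True \<longleftrightarrow> \<tau> b = Some True))" for v
  \<comment> \<open>A model has exactly the variables of the formula as its domain, hence the
    default \<open>None\<close>. This is why the fact on \<open>\<tau>'\<close> and
    \<open>E a b\<close> below assumes that \<open>E a b\<close> occurs in the encoding.\<close>
  define \<tau>' where "\<tau>' v = (if v \<in> vars \<phi> then \<tau> v
    else if v \<in> vars (Eq m x e \<phi>) then Some (val v) else None)" for v
  have dom: "dom \<tau> = vars \<phi>" and sat: "\<And>C. C \<in> \<phi> \<Longrightarrow> satisfies \<tau> C"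
    using \<tau> by (auto simp: models_def)
  have "vars (\<phi> \<union> Eq m x e \<phi>) = vars \<phi> \<union> vars (Eq m x e \<phi>)"
    by (simp add: vars_def)
  then have dom': "dom \<tau>' = vars (\<phi> \<union> Eq m x e \<phi>)"
    using dom by (auto simp: \<tau>'_def dom_def split: if_splits)
  have val_E: "val (E a b) \<longleftrightarrow> (\<tau> a = Some True \<longleftrightarrow> \<tau> b = Some True)"
    if "a \<in> vars \<phi>" "b \<in> vars \<phi>" "a \<noteq> b" for a b
  proof
    assume "val (E a b)"
    then obtain c d where cd: "c \<in> vars \<phi>" "d \<in> vars \<phi>" "c \<noteq> d" "E a b = E c d"
      "\<tau> c = Some True \<longleftrightarrow> \<tau> d = Some True"
      unfolding val_def by blast
    then have "{a, b} = {c, d}"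
      using E_inj[of a b c d] that by blast
    then show "\<tau> a = Some True \<longleftrightarrow> \<tau> b = Some True"
      using cd(5) by (auto simp: doubleton_eq_iff)
  qed (use that in \<open>auto simp: val_def\<close>)
  have \<tau>'_E: "\<tau>' (E a b) = Some True \<longleftrightarrow> (\<tau> a = Some True \<longleftrightarrow> \<tau> b = Some True)"
    if "E a b \<in> vars (Eq m x e \<phi>)" "a \<in> vars \<phi>" "b \<in> vars \<phi>" "a \<noteq> b" for a b
    using that E_fresh val_E by (simp add: \<tau>'_def)
  have "satisfies \<tau>' C" if C: "C \<in> \<phi>" for C
  proof -
    have "satisfies \<tau>' C = satisfies \<tau> C"
      using clause_vars[OF C] by (intro satisfies_cong) (auto simp: \<tau>'_def)
    then show ?thesis
      using sat[OF C] by simp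
  qed
  moreover have "satisfies \<tau>' C" if C: "C \<in> Eq m x e \<phi>" for C
  proof -
    have CV: "cvars C \<subseteq> vars (Eq m x e \<phi>)"
      using C by (auto simp: vars_def)
    from C show ?thesis
    proof (cases rule: Eq_cases)
      case (edge u v w p)
      have uvw: "u \<in> vars \<phi>" "v \<in> vars \<phi>" "w \<in> vars \<phi>" "u \<noteq> v" "v \<noteq> w" "u \<noteq> w"
        using clause_vars[OF edge(1)] clause_distinct[OF edge(1)] by auto
      have Ew: "E u v \<noteq> w"
        using E_fresh[of u v] uvw by blast
      have "\<tau>' w = \<tau> w"
        using uvw by (simp add: \<tau>'_def)
      moreover have "\<tau>' (E u v) = Some True \<longleftrightarrow> (\<tau> u = Some True \<longleftrightarrow> \<tau> v = Some True)"
        using CV edge(2) uvw by (intro \<tau>'_E) auto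
      \<comment> \<open>\<open>E u v\<close> takes the negation of the xor of \<open>u\<close> and
        \<open>v\<close>, so putting it in their place flips the parity \<open>p\<close>. As
        \<open>E u v\<close> differs from \<open>w\<close>, the clause really is a sum of two
        terms.\<close>
      ultimately show ?thesis
        using sat[OF edge(1)] uvw Ew edge(2) by (auto simp: satisfies_def big_xor_insert)
    next
      case (triangle u v w)
      have uvw: "u \<in> vars \<phi>" "v \<in> vars \<phi>" "w \<in> vars \<phi>" "u \<noteq> v" "v \<noteq> w" "u \<noteq> w"
        using triangle(1,2) by auto
      have "E u v \<noteq> E v w" "E u v \<noteq> E u w" "E v w \<noteq> E u w"
        using E_inj[of u v v w] E_inj[of u v u w] E_inj[of v w u w] uvw
        by (auto simp: doubleton_eq_iff)
      moreover have "\<tau>' (E u v) = Some True \<longleftrightarrow> (\<tau> u = Some True \<longleftrightarrow> \<tau> v = Some True)"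
        "\<tau>' (E v w) = Some True \<longleftrightarrow> (\<tau> v = Some True \<longleftrightarrow> \<tau> w = Some True)"
        "\<tau>' (E u w) = Some True \<longleftrightarrow> (\<tau> u = Some True \<longleftrightarrow> \<tau> w = Some True)"
        using CV triangle(3) uvw by (simp_all add: \<tau>'_E)
      \<comment> \<open>Among three truth values either exactly one pair or all three pairs agree,
        so an odd number of the equality variables is true.\<close>
      ultimately show ?thesis
        using triangle(3) by (auto simp: satisfies_def big_xor_insert)
    qed
  qed
  ultimately have "\<tau>' \<in> models (\<phi> \<union> Eq m x e \<phi>)"
    using dom' by (auto simp: models_def)
  moreover have "\<tau>' |` vars \<phi> = \<tau>"
    using dom domIff by (fastforce simp: fun_eq_iff restrict_map_def \<tau>'_def)
  ultimately show thesis
    using that by blast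
qed

lemma models_Eq: "models \<phi> = (\<lambda>\<tau>. \<tau> |` vars \<phi>) ` models (\<phi> \<union> Eq m x e \<phi>)"
proof (intro equalityI subsetI)
  fix \<tau> assume "\<tau> \<in> models \<phi>"
  then show "\<tau> \<in> (\<lambda>\<tau>. \<tau> |` vars \<phi>) ` models (\<phi> \<union> Eq m x e \<phi>)"
    by (metis image_eqI model_extension)
next
  fix \<tau> assume "\<tau> \<in> (\<lambda>\<tau>. \<tau> |` vars \<phi>) ` models (\<phi> \<union> Eq m x e \<phi>)"
  then obtain \<tau>' where \<tau>': "\<tau>' \<in> models (\<phi> \<union> Eq m x e \<phi>)" and \<tau>: "\<tau> = \<tau>' |` vars \<phi>"
    by blast
  have "dom \<tau> = vars \<phi>"
    using \<tau>' \<tau> by (auto simp: models_def vars_def)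
  moreover have "satisfies \<tau> C" if C: "C \<in> \<phi>" for C
  proof -
    have "satisfies \<tau> C = satisfies \<tau>' C"
      using clause_vars[OF C] \<tau> by (intro satisfies_cong) auto
    then show ?thesis
      using \<tau>' C by (simp add: models_def)
  qed
  ultimately show "\<tau> \<in> models \<phi>"
    by (auto simp: models_def)
qed

section \<open>Simulation of EC derivations by unit propagation\<close>

context
  fixes L :: "'v xor_formula"
  assumes L: "L \<subseteq> lits \<phi>"
begin

abbreviation derives :: "'v xor_clause \<Rightarrow> bool" where
  "derives \<equiv> derivable UP ((\<phi> \<union> Eq m x e \<phi>) \<union> L)"

text \<open>Says more than that UP derives \<open>Xor {u, v} b\<close>: it remembers the ternary
  clause of origin, whose edge clause gives access to \<open>E u v\<close>.\<close>

definition reduced :: "'v \<Rightarrow> 'v \<Rightarrow> bool \<Rightarrow> bool" where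
  "reduced u v b \<longleftrightarrow> (\<exists>w p c. Xor {u, v, w} p \<in> \<phi> \<and> derives (unit_xor w c) \<and> b = (c \<noteq> p))"

text \<open>The invariant for induction over EC-derivations. Every EC conclusion has at most two
  variables, so ternary clauses can only come from \<phi>. The empty clause carries no obligation:
  it is neither a literal nor a premise of an EC rule.\<close>

definition simulated :: "'v xor_clause \<Rightarrow> bool" where
  "simulated C \<longleftrightarrow>
     (card (cvars C) = 3 \<longrightarrow> C \<in> \<phi>) \<and>
     (\<forall>u b. C = unit_xor u b \<longrightarrow> derives C) \<and>
     (\<forall>u v b. u \<noteq> v \<longrightarrow> C = Xor {u, v} b \<longrightarrow> reduced u v b)"

lemma simulated_unit [simp]: "simulated (unit_xor u b) \<longleftrightarrow> derives (unit_xor u b)"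
  by (auto simp: simulated_def)

lemma simulated_bot: "simulated xor_bot"
  by (auto simp: simulated_def)

lemma simulated_ternary:
  assumes "simulated (Xor {u, v, w} p)" "distinct [u, v, w]"
  shows "Xor {u, v, w} p \<in> \<phi>"
  using assms by (simp add: simulated_def)

lemma reduced_sym: "reduced u v b \<longleftrightarrow> reduced v u b"
  by (simp add: reduced_def insert_commute)

lemma simulated_binary: "u \<noteq> v \<Longrightarrow> simulated (Xor {u, v} b) \<longleftrightarrow> reduced u v b"
  by (auto simp: simulated_def doubleton_eq_iff reduced_sym)

lemma reduced_vars: "reduced u v b \<Longrightarrow> u \<in> vars \<phi> \<and> v \<in> vars \<phi>"
  using clause_vars by (fastforce simp: reduced_def)

text \<open>UP replays the two eliminations: first \<open>w\<close> from the ternary clause, then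
  \<open>u\<close> from the resulting binary one.\<close>

lemma reduced_unit:
  assumes "reduced u v b" "derives (unit_xor u a)"
  shows "derives (unit_xor v (a \<noteq> b))"
proof -
  obtain w p c where C: "Xor {u, v, w} p \<in> \<phi>" and w: "derives (unit_xor w c)" and b: "b = (c \<noteq> p)"
    using assms(1) reduced_def by blast
  have "derives (Xor {w, u, v} p)"
    using C by (intro derivable_base) (simp add: insert_commute)
  then have "derives (Xor {u, v} b)"
    using derivable_UP_ternary[OF w] clause_distinct[OF C] b by fastforce
  then show ?thesis
    using derivable_UP_binary[OF assms(2)] clause_distinct[OF C] by simp
qed

text \<open>Propagating \<open>w\<close> into the edge clause fixes \<open>E u v\<close>. The value
  is negated because \<open>b\<close> is the xor of \<open>u\<close> and \<open>v\<close> while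
  \<open>E u v\<close> stands for their equality.\<close>

lemma reduced_edge:
  assumes "reduced u v b"
  shows "derives (unit_xor (E u v) (\<not> b))"
proof -
  obtain w p c where C: "Xor {u, v, w} p \<in> \<phi>" and w: "derives (unit_xor w c)" and b: "b = (c \<noteq> p)"
    using assms reduced_def by blast
  have "derives (Xor {w, E u v} (\<not> p))"
    using edge_clause_mem[OF C] by (intro derivable_base) (simp add: insert_commute)
  moreover have "w \<noteq> E u v"
    using E_fresh[of u v] clause_vars[OF C] clause_distinct[OF C] by auto
  ultimately have "derives (unit_xor (E u v) (c \<noteq> (\<not> p)))"
    using derivable_UP_binary[OF w] by blast
  then show ?thesis
    using b by simp
qed

text \<open>Two known variables of a triangle clause force the third. The order in
  \<open>b \<noteq> a\<close> matches \<open>big_xor_insert\<close>, with the newest edge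
  first.\<close>

lemma triangle_propagation:
  assumes "u \<in> vars \<phi>" "v \<in> vars \<phi>" "w \<in> vars \<phi>" "distinct [u, v, w]"
    and "derives (unit_xor (E u v) (\<not> a))" "derives (unit_xor (E v w) (\<not> b))"
  shows "derives (unit_xor (E u w) (\<not> (b \<noteq> a)))"
proof -
  have "E u v \<noteq> E v w" "E u v \<noteq> E u w" "E v w \<noteq> E u w"
    using E_inj[of u v v w] E_inj[of u v u w] E_inj[of v w u w] assms(1-4)
    by (auto simp: doubleton_eq_iff)
  moreover have "derives (Xor {E u v, E v w, E u w} True)"
    using triangle_clause_mem assms(1-4) by (intro derivable_base) auto
  ultimately have "derives (unit_xor (E u w) ((\<not> b) \<noteq> ((\<not> a) \<noteq> True)))"
    using derivable_UP_binary[OF assms(6) derivable_UP_ternary[OF assms(5)]] by force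
  moreover have "((\<not> b) \<noteq> ((\<not> a) \<noteq> True)) = (\<not> (b \<noteq> a))"
    by blast
  ultimately show ?thesis
    by metis
qed

text \<open>Induction along the path: the triangle on the start, the current end and the next vertex
  extends the known equality by one edge. Injectivity of \<open>z\<close> makes these three vertices
  distinct, so that the triangle clause exists.\<close>

lemma path_edge:
  assumes inj: "inj_on z {1..n}"
    and red: "\<And>i. 1 \<le> i \<Longrightarrow> i < n \<Longrightarrow> reduced (z i) (z (i + 1)) (c i)"
    and "1 \<le> k" "k < n"
  shows "derives (unit_xor (E (z 1) (z (Suc k))) (\<not> big_xor c {1..<Suc k}))"
  using assms(3,4)
proof (induction k rule: nat_induct_at_least)
  case base
  have "big_xor c {1..<Suc 1} = c 1"
    using big_xor_insert[of "{}" 1 c] by simp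
  then show ?case
    using reduced_edge[OF red[of 1]] base by simp
next
  case (Suc k)
  have "z 1 \<in> vars \<phi>" "z (Suc k) \<in> vars \<phi>" "z (Suc (Suc k)) \<in> vars \<phi>"
    using reduced_vars[OF red[of 1]] reduced_vars[OF red[of "Suc k"]] Suc by auto
  moreover have "distinct [z 1, z (Suc k), z (Suc (Suc k))]"
    using Suc inj by (auto simp: inj_on_eq_iff)
  moreover have "derives (unit_xor (E (z (Suc k)) (z (Suc (Suc k)))) (\<not> c (Suc k)))"
    using reduced_edge[OF red[of "Suc k"]] Suc by simp
  moreover have "{1..<Suc (Suc k)} = insert (Suc k) {1..<Suc k}"
    using Suc by auto
  then have "big_xor c {1..<Suc (Suc k)} = (c (Suc k) \<noteq> big_xor c {1..<Suc k})"
    by (simp add: big_xor_insert)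
  ultimately show ?case
    using triangle_propagation Suc by simp
qed

lemma simulated_base:
  assumes "C \<in> \<phi> \<union> L"
  shows "simulated C"
proof (cases "C \<in> \<phi>")
  case True
  then show ?thesis
    using clause_card[OF True] by (auto simp: simulated_def)
next
  case False
  then obtain u b where "C = unit_xor u b" "C \<in> L"
    using assms L by (auto simp: lits_def)
  then show ?thesis
    by (auto intro: derivable_base)
qed

lemma simulated_step:
  assumes "EC P C" "\<And>A. A \<in> P \<Longrightarrow> simulated A"
  shows "simulated C"
  using assms
proof (cases rule: EC.cases)
  case conflict
  then show ?thesis by (simp add: simulated_bot)
next
  case (unit2 u v a b)
  have "derives (unit_xor u a)"
    using assms(2)[of "unit_xor u a"] unit2(1) by simp
  moreover have "reduced u v b"
    using assms(2)[of "Xor {u, v} b"] unit2(1,3) by (simp add: simulated_binary)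
  ultimately show ?thesis
    using reduced_unit unit2(2) by simp
next
  case (unit3 u v w a b)
  have u: "derives (unit_xor u a)"
    using assms(2)[of "unit_xor u a"] unit3(1) by simp
  have "Xor {u, v, w} b \<in> \<phi>"
    using assms(2)[of "Xor {u, v, w} b"] unit3(1,3) simulated_ternary by simp
  \<comment> \<open>The eliminated variable goes last, the place of the witness in
    \<open>reduced\<close>.\<close>
  then have "Xor {v, w, u} b \<in> \<phi>"
    by (simp add: insert_commute)
  then have "reduced v w (a \<noteq> b)"
    using u reduced_def by blast
  then show ?thesis
    using unit3 by (simp add: simulated_binary)
next
  case (path n z y c d)
  have red: "reduced (z i) (z (i + 1)) (c i)" if "1 \<le> i" "i < n" for i
  proof -
    have "z i \<noteq> z (i + 1)"
      using path(4) that by (auto simp: inj_on_eq_iff)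
    moreover have "simulated (Xor {z i, z (i + 1)} (c i))"
      using assms(2) path(1) that by blast
    ultimately show ?thesis
      by (simp add: simulated_binary)
  qed
  \<comment> \<open>\<open>k\<close> counts the edges of the path, so its last vertex is
    \<open>z (Suc k)\<close>, that is, \<open>z n\<close>.\<close>
  obtain k where k: "n = Suc k" "1 \<le> k"
    using path(3) by (cases n) auto
  have edge: "derives (unit_xor (E (z 1) (z n)) (\<not> big_xor c {1..<n}))"
    using path_edge[OF path(4) red, of k] k by simp
  \<comment> \<open>With distinct end points the last premise has three variables, so by the
    invariant it belongs to \<phi> and has an edge clause for its end points. Whether
    \<open>y\<close> is an inner vertex does not matter.\<close>
  have "z 1 \<noteq> z n"
    using path(4) k by (auto simp: inj_on_eq_iff)
  then have C: "Xor {z 1, z n, y} d \<in> \<phi>"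
    using assms(2)[of "Xor {z 1, z n, y} d"] path(1,5,6) simulated_ternary by simp
  then have "derives (Xor {E (z 1) (z n), y} (\<not> d))"
    using edge_clause_mem by (intro derivable_base) simp
  moreover have "E (z 1) (z n) \<noteq> y"
    using E_fresh[of "z 1" "z n"] clause_vars[OF C] clause_distinct[OF C] by auto
  \<comment> \<open>The two negations cancel, which leaves the parity of the conclusion of
    \<open>path\<close>.\<close>
  ultimately have "derives (unit_xor y ((\<not> big_xor c {1..<n}) \<noteq> (\<not> d)))"
    using derivable_UP_binary[OF edge] by blast
  then show ?thesis
    using path(2) by simp
next
  case cycle
  then show ?thesis by (simp add: simulated_bot)
qed

lemma EC_simulation:
  assumes "derivable EC (\<phi> \<union> L) l" "is_literal l"
  shows "derives l"
proof -
  have "simulated l"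
  proof (rule derivable_induct[OF assms(1)])
    show "simulated C" if "C \<in> \<phi> \<union> L" for C
      using that by (rule simulated_base)
    show "simulated C" if "EC P C" "\<And>A. A \<in> P \<Longrightarrow> simulated A" for P C
      using that by (rule simulated_step)
  qed
  then show ?thesis
    using assms(2) by (auto simp: is_literal_def)
qed

end

lemma EC_simulation_formula_Eq: "EC_simulation_formula \<phi> (Eq m x e \<phi>)"
  unfolding EC_simulation_formula_def
  using xor_formula_Eq models_Eq EC_simulation by blast

end

theorem theorem4:
  fixes \<phi> :: "'v xor_formula"
    and m :: nat
    and x :: "nat \<Rightarrow> 'v"
    and e :: "nat \<Rightarrow> nat \<Rightarrow> 'v"
  assumes "xor_formula \<phi>"
    and "three_xor_normal_form \<phi>"
    and "bij_betw x {1..m} (vars \<phi>)"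
    and "\<And>i j. i \<in> {1..m} \<Longrightarrow> j \<in> {1..m} \<Longrightarrow> i \<noteq> j \<Longrightarrow> e i j = e j i"
    and "\<And>i j. i \<in> {1..m} \<Longrightarrow> j \<in> {1..m} \<Longrightarrow> i \<noteq> j \<Longrightarrow> e i j \<notin> vars \<phi>"
    and "\<And>i j k l. {i, j, k, l} \<subseteq> {1..m} \<Longrightarrow> i \<noteq> j \<Longrightarrow> k \<noteq> l \<Longrightarrow> {i, j} \<noteq> {k, l} \<Longrightarrow> e i j \<noteq> e k l"
  shows "EC_simulation_formula \<phi> (Eq m x e \<phi>)"
  by (rule equality_encoding.EC_simulation_formula_Eq, rule equality_encoding.intro)
    (rule assms(1) assms(2) assms(3)
      | (rule assms(4); assumption) | (rule assms(5); assumption) | (rule assms(6); assumption))+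

end
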